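(* Let $f:\mathbb{R}^{n_\phi}\to\mathbb{R}^p$ have bounded gain and let $\mathcal{S}\subset\mathbb{R}^{p\times d_y}$ be a bounded set. Suppose that a controller $(g_1,g_2,h,\mathcal{X})$ of the form described in the context provides a convolution bound for $(f,\mathcal{S})$ with gain $c\ge 1$ and decay rate $\lambda\in(0,1)$. Then for every $\lambda_1\in(\lambda,1)$ and every $c_0>0$ there exist $c_1\ge c$ and $\epsilon>0$ such that the same controller provides a convolution bound for $(f,s(\mathcal{S},c_0,\epsilon))$ with gain $c_1$ and decay rate $\lambda_1$.
   Context: Notation. $\|\cdot\|$ is the Euclidean norm of a vector and the corresponding induced norm of a matrix. $\mathbb{S}(\mathbb{R}^{k})$ is the set of all $\mathbb{R}^{k}$-valued sequences (indexed by $\mathbb{Z}$), and $\boldsymbol\ell_\infty(\mathbb{R}^{p\times d_y})$ is the set of bounded $\mathbb{R}^{p\times d_y}$-valued sequences indexed by $\mathbb{Z}$. A function $\Gamma:\mathbb{R}^a\to\mathbb{R}^b$ has a bounded gain if there is $\nu>0$ with $\|\Gamma(x)\|\le\nu\|x\|$ for all $x\in\mathbb{R}^a$. Plant. Fix dimensions $d_y,d_u,p,n_y,n_u\in\mathbb{N}$ and put $n_\phi=n_y d_y+n_u d_u$. With output $y(t)\in\mathbb{R}^{d_y}$, input $u(t)\in\mathbb{R}^{d_u}$ and disturbance $w(t)\in\mathbb{R}^{d_y}$, let $\phi(t)\in\mathbb{R}^{n_\phi}$ be the column vector obtained by stacking $y(t),y(t-1),\dots,y(t-n_y+1),u(t),u(t-1),\dots,u(t-n_u+1)$.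 For a constant parameter $\theta^*\in\mathcal{S}$ the time-invariant plant is $$y(t+1)={\theta^*}^\top f(\phi(t))+w(t),\quad t\ge t_0,\qquad \phi(t_0)=\phi_0,$$ and for a parameter sequence $\theta^*(\cdot)$ the time-varying plant is $$y(t+1)=\theta^*(t)^\top f(\phi(t))+w(t),\quad t\ge t_0,\qquad \phi(t_0)=\phi_0.$$ Controller. Fix integers $l_1,l_2,q\ge0$ and a set $\mathcal{X}\subset\mathbb{R}^{l_2}$. The controller has states $z_1(t)\in\mathbb{R}^{l_1}$, $z_2(t)\in\mathbb{R}^{l_2}$ and an exogenous signal $r(t)\in\mathbb{R}^q$, and is given for $t\ge t_0$ by $$z_1(t+1)=g_1(z_1(t),z_2(t),\phi(t),y(t+1),r(t),t,t_0),\quad z_1(t_0)=z_{1_0},$$ $$z_2(t+1)=g_2(z_1(t),z_2(t),\phi(t),y(t+1),r(t),t,t_0),\quad z_2(t_0)=z_{2_0},$$ $$u(t)=h(z_1(t),z_2(t),\phi(t),r(t)),$$ where $g_1$ is $\mathbb{R}^{l_1}$-valued, $h$ is $\mathbb{R}^{d_u}$-valued, and $g_2:\mathbb{R}^{l_1}\times\mathcal{X}\times\mathbb{R}^{n_\phi}\times\mathbb{R}^{d_y}\times\mathbb{R}^q\times\mathbb{Z}\times\mathbb{Z}\to\mathcal{X}$ (so $z_2$ stays in $\mathcal{X}$ if $z_{2_0}\in\mathcal{X}$). Applying the controller to a plant means that $y,u,z_1,z_2$ satisfy the plant and controller equations simultaneously for all $t\ge t_0$. Convolution bound for $(f,\mathcal{S})$.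 The controller provides a convolution bound for $(f,\mathcal{S})$ with gain $c\ge1$ and decay rate $\lambda\in(0,1)$ if for every $\theta^*\in\mathcal{S}$, $t_0\in\mathbb{Z}$, $\phi_0\in\mathbb{R}^{n_\phi}$, $z_{1_0}\in\mathbb{R}^{l_1}$, $z_{2_0}\in\mathcal{X}$, $w\in\mathbb{S}(\mathbb{R}^{d_y})$ and $r\in\mathbb{S}(\mathbb{R}^q)$, when the controller is applied to the time-invariant plant with parameter $\theta^*$, for all integers $t\ge\tau\ge t_0$: $$\left\|\begin{bmatrix} \phi(t) \\ z_1(t) \end{bmatrix}\right\|\le c\lambda^{t-\tau}\left\|\begin{bmatrix} \phi(\tau) \\ z_1(\tau) \end{bmatrix}\right\|+\sum_{j=\tau}^{t-1}c\lambda^{t-j-1}(\|r(j)\|+\|w(j)\|)+c\|r(t)\|.$$ Time-variation class. For $c_0\ge0$, $\epsilon>0$, $s(\mathcal{S},c_0,\epsilon)$ is the set of $\theta^*\in\boldsymbol\ell_\infty(\mathbb{R}^{p\times d_y})$ such that $\theta^*(t)\in\mathcal{S}$ for all $t\in\mathbb{Z}$ and $\sum_{t=t_1}^{t_2-1}\|\theta^*(t+1)-\theta^*(t)\|\le c_0+\epsilon(t_2-t_1)$ for all integers $t_2>t_1$. Convolution bound for $(f,s(\mathcal{S},c_0,\epsilon))$. The controller provides a convolution bound for $(f,s(\mathcal{S},c_0,\epsilon))$ with gain $c\ge1$ and decay rate $\lambda\in(0,1)$ if for every $\theta^*\in s(\mathcal{S},c_0,\epsilon)$, $t_0\in\mathbb{Z}$,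 $\phi_0\in\mathbb{R}^{n_\phi}$, $z_{1_0}\in\mathbb{R}^{l_1}$, $z_{2_0}\in\mathcal{X}$, $w\in\mathbb{S}(\mathbb{R}^{d_y})$ and $r\in\mathbb{S}(\mathbb{R}^q)$, when the controller is applied to the time-varying plant with parameter sequence $\theta^*(\cdot)$, for all integers $t\ge\tau\ge t_0$: $$\left\|\begin{bmatrix} \phi(t) \\ z_1(t) \end{bmatrix}\right\|\le c\lambda^{t-\tau}\left\|\begin{bmatrix} \phi(\tau) \\ z_1(\tau) \end{bmatrix}\right\|+\sum_{j=\tau}^{t-1}c\lambda^{t-j-1}(\|r(j)\|+\|w(j)\|)+c\|r(t)\|.$$ *)

theory Defs
  imports "HOL-Analysis.L2_Norm" "Jordan_Normal_Form.Matrix"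
begin

(* Dimensions may vanish (e.g. a controller without z1, z2 or r), so vectors and matrices
   are those of Jordan_Normal_Form, with explicit carriers, rather than real^'n. *)

definition vec_nrm :: "real vec \<Rightarrow> real" where
  "vec_nrm v = L2_set (\<lambda>i. v $ i) {..<dim_vec v}"

(* Same shape as onorm; v = 0 contributes the value 0, so the formula is also
   correct for matrices without columns. *)
definition mat_nrm :: "real mat \<Rightarrow> real" where
  "mat_nrm A = (SUP v\<in>carrier_vec (dim_col A). vec_nrm (A *\<^sub>v v) / vec_nrm v)"

definition seqs :: "nat \<Rightarrow> (int \<Rightarrow> real vec) set" where
  "seqs k = {x. \<forall>t. x t \<in> carrier_vec k}"

definition bounded_mats :: "real mat set \<Rightarrow> bool" where
  "bounded_mats S \<longleftrightarrow> (\<exists>B. \<forall>A\<in>S. mat_nrm A \<le> B)"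

definition linf_seqs :: "nat \<Rightarrow> nat \<Rightarrow> (int \<Rightarrow> real mat) set" where
  "linf_seqs m n = {\<theta>. (\<forall>t. \<theta> t \<in> carrier_mat m n) \<and> bounded_mats (range \<theta>)}"

definition bounded_gain :: "nat \<Rightarrow> (real vec \<Rightarrow> real vec) \<Rightarrow> bool" where
  "bounded_gain a \<Gamma> \<longleftrightarrow> (\<exists>\<nu>>0. \<forall>x\<in>carrier_vec a. vec_nrm (\<Gamma> x) \<le> \<nu> * vec_nrm x)"

record dims =
  dim_y :: nat
  dim_u :: nat
  dim_p :: nat
  lag_y :: nat
  lag_u :: nat
  dim_z1 :: nat
  dim_z2 :: nat
  dim_r :: nat

definition n_phi :: "dims \<Rightarrow> nat" where
  "n_phi D = lag_y D * dim_y D + lag_u D * dim_u D"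

definition stack :: "real vec list \<Rightarrow> real vec" where
  "stack vs = foldr append_vec vs vNil"

definition regressor ::
  "dims \<Rightarrow> (int \<Rightarrow> real vec) \<Rightarrow> (int \<Rightarrow> real vec) \<Rightarrow> int \<Rightarrow> real vec" where
  "regressor D y u t =
     stack (map (\<lambda>k. y (t - int k)) [0..<lag_y D] @ map (\<lambda>k. u (t - int k)) [0..<lag_u D])"

(* Arguments of the update maps: z1(t), z2(t), phi(t), y(t+1), r(t), t, t0;
   arguments of the control law: z1(t), z2(t), phi(t), r(t). *)
record controller =
  upd1 :: "real vec \<Rightarrow> real vec \<Rightarrow> real vec \<Rightarrow> real vec \<Rightarrow> real vec \<Rightarrow> int \<Rightarrow> int \<Rightarrow> real vec"
  upd2 :: "real vec \<Rightarrow> real vec \<Rightarrow> real vec \<Rightarrow> real vec \<Rightarrow> real vec \<Rightarrow> int \<Rightarrow> int \<Rightarrow> real vec"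
  law :: "real vec \<Rightarrow> real vec \<Rightarrow> real vec \<Rightarrow> real vec \<Rightarrow> real vec"
  z2_set :: "real vec set"

definition wf_controller :: "dims \<Rightarrow> controller \<Rightarrow> bool" where
  "wf_controller D C \<longleftrightarrow>
     z2_set C \<subseteq> carrier_vec (dim_z2 D) \<and>
     (\<forall>a\<in>carrier_vec (dim_z1 D). \<forall>b\<in>z2_set C. \<forall>\<phi>\<in>carrier_vec (n_phi D). \<forall>r\<in>carrier_vec (dim_r D).
        law C a b \<phi> r \<in> carrier_vec (dim_u D) \<and>
        (\<forall>y\<in>carrier_vec (dim_y D). \<forall>t t0.
           upd1 C a b \<phi> y r t t0 \<in> carrier_vec (dim_z1 D) \<and>
           upd2 C a b \<phi> y r t t0 \<in> z2_set C))"

(* A relation between signals: phi(t) contains u(t), so the control law is an implicit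
   equation for u(t), and phi0 constrains y and u up to time t0. *)
definition closed_loop ::
  "dims \<Rightarrow> (real vec \<Rightarrow> real vec) \<Rightarrow> controller \<Rightarrow> (int \<Rightarrow> real mat) \<Rightarrow> int \<Rightarrow>
   real vec \<Rightarrow> real vec \<Rightarrow> real vec \<Rightarrow> (int \<Rightarrow> real vec) \<Rightarrow> (int \<Rightarrow> real vec) \<Rightarrow>
   (int \<Rightarrow> real vec) \<Rightarrow> (int \<Rightarrow> real vec) \<Rightarrow> (int \<Rightarrow> real vec) \<Rightarrow> (int \<Rightarrow> real vec) \<Rightarrow> bool" where
  "closed_loop D f C \<theta> t0 \<phi>0 z10 z20 w r y u z1 z2 \<longleftrightarrow>
     regressor D y u t0 = \<phi>0 \<and> z1 t0 = z10 \<and> z2 t0 = z20 \<and>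
     (\<forall>t\<ge>t0.
        y (t + 1) = transpose_mat (\<theta> t) *\<^sub>v f (regressor D y u t) + w t \<and>
        z1 (t + 1) = upd1 C (z1 t) (z2 t) (regressor D y u t) (y (t + 1)) (r t) t t0 \<and>
        z2 (t + 1) = upd2 C (z1 t) (z2 t) (regressor D y u t) (y (t + 1)) (r t) t t0 \<and>
        u t = law C (z1 t) (z2 t) (regressor D y u t) (r t))"

definition convolution_bound ::
  "dims \<Rightarrow> (real vec \<Rightarrow> real vec) \<Rightarrow> (int \<Rightarrow> real mat) set \<Rightarrow> controller \<Rightarrow> real \<Rightarrow> real \<Rightarrow> bool" where
  "convolution_bound D f \<Theta> C c lam \<longleftrightarrow>
     1 \<le> c \<and> 0 < lam \<and> lam < 1 \<and>
     (\<forall>\<theta>\<in>\<Theta>. \<forall>t0. \<forall>\<phi>0\<in>carrier_vec (n_phi D). \<forall>z10\<in>carrier_vec (dim_z1 D). \<forall>z20\<in>z2_set C.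
      \<forall>w\<in>seqs (dim_y D). \<forall>r\<in>seqs (dim_r D). \<forall>y\<in>seqs (dim_y D). \<forall>u\<in>seqs (dim_u D). \<forall>z1 z2.
        closed_loop D f C \<theta> t0 \<phi>0 z10 z20 w r y u z1 z2 \<longrightarrow>
        (\<forall>\<tau>\<ge>t0. \<forall>t\<ge>\<tau>.
           vec_nrm (regressor D y u t @\<^sub>v z1 t)
             \<le> c * lam ^ nat (t - \<tau>) * vec_nrm (regressor D y u \<tau> @\<^sub>v z1 \<tau>)
               + (\<Sum>j\<in>{\<tau>..<t}. c * lam ^ nat (t - j - 1) * (vec_nrm (r j) + vec_nrm (w j)))
               + c * vec_nrm (r t)))"

(* The time-invariant plant with parameter A is the plant with parameter sequence %t. A. *)
definition const_params :: "real mat set \<Rightarrow> (int \<Rightarrow> real mat) set" where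
  "const_params S = {\<lambda>t. A | A. A \<in> S}"

definition slow_params :: "dims \<Rightarrow> real mat set \<Rightarrow> real \<Rightarrow> real \<Rightarrow> (int \<Rightarrow> real mat) set" where
  "slow_params D S c0 \<epsilon> =
     {\<theta> \<in> linf_seqs (dim_p D) (dim_y D).
        (\<forall>t. \<theta> t \<in> S) \<and>
        (\<forall>t1 t2. t1 < t2 \<longrightarrow>
           (\<Sum>t\<in>{t1..<t2}. mat_nrm (\<theta> (t + 1) - \<theta> t)) \<le> c0 + \<epsilon> * of_int (t2 - t1))}"

end

theory Submission
  imports Defs
begin

text \<open>
  Any trajectory of the time-varying loop is also a trajectory of the loop with the parameter frozen
  at its value at a time \<open>T\<close>, provided the parameter error is moved into the disturbance, which is
  arbitrary in the hypothesis. On \<open>[T, T + N]\<close> this error is at most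
  \<open>\<nu> \<eta>(j) \<parallel>x(j)\<parallel>\<close>, where \<open>\<eta>(j)\<close> is the variation over the \<open>N\<close> steps before \<open>j\<close> and thus does not
  depend on \<open>T\<close>. Gronwall's inequality costs a factor \<open>exp (g \<Sum>\<eta>)\<close> with \<open>g = c \<nu> / \<lambda>\<close>, which is multiplicative
  across blocks, so it suffices to choose \<open>N\<close> with \<open>c \<lambda>^N \<le> \<rho>^N\<close> for some \<open>\<rho>\<close> between \<open>\<lambda>\<close> and
  \<open>\<lambda>\<^sub>1\<close>. Since \<open>\<Sum>\<eta> \<le> N (c\<^sub>0 + \<epsilon> (t - j))\<close>, a small \<open>\<epsilon>\<close> turns \<open>\<rho>\<close> into \<open>\<lambda>\<^sub>1\<close>.
\<close>

section \<open>Euclidean norm and induced matrix norm\<close>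

lemma vec_nrm_nonneg: "0 \<le> vec_nrm v"
  by (simp add: vec_nrm_def L2_set_nonneg)

lemma vec_nrm_square: "vec_nrm v ^ 2 = v \<bullet> v"
  unfolding vec_nrm_def L2_set_def scalar_prod_def
  by (simp add: sum_nonneg power2_eq_square atLeast0LessThan)

lemma vec_nrm_zero: "vec_nrm (0\<^sub>v n) = 0"
  by (simp add: vec_nrm_def L2_set_def)

lemma vec_nrm_add_le:
  assumes "v \<in> carrier_vec n" "w \<in> carrier_vec n"
  shows "vec_nrm (v + w) \<le> vec_nrm v + vec_nrm w"
proof -
  have "vec_nrm (v + w) = L2_set (\<lambda>i. v $ i + w $ i) {..<n}"
    unfolding vec_nrm_def using assms by (intro L2_set_cong) auto
  then show ?thesis
    using L2_set_triangle_ineq[of "\<lambda>i. v $ i" "\<lambda>i. w $ i" "{..<n}"] assms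
    by (simp add: vec_nrm_def)
qed

lemma abs_scalar_prod_le:
  assumes "v \<in> carrier_vec n" "w \<in> carrier_vec n"
  shows "\<bar>v \<bullet> w\<bar> \<le> vec_nrm v * vec_nrm w"
proof -
  have "\<bar>v \<bullet> w\<bar> \<le> (\<Sum>i<n. \<bar>v $ i\<bar> * \<bar>w $ i\<bar>)"
    using assms unfolding scalar_prod_def
    by (auto simp: atLeast0LessThan abs_mult[symmetric] intro!: sum_abs)
  also have "\<dots> \<le> vec_nrm v * vec_nrm w"
    using L2_set_mult_ineq[of "\<lambda>i. v $ i" "\<lambda>i. w $ i" "{..<n}"] assms
    by (simp add: vec_nrm_def)
  finally show ?thesis .
qed

lemma vec_nrm_append_ge: "vec_nrm v \<le> vec_nrm (v @\<^sub>v w)"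
proof -
  have "vec_nrm v = L2_set (\<lambda>i. (v @\<^sub>v w) $ i) {..<dim_vec v}"
    unfolding vec_nrm_def by (intro L2_set_cong) auto
  also have "\<dots> \<le> vec_nrm (v @\<^sub>v w)"
    unfolding vec_nrm_def L2_set_def by (intro real_sqrt_le_mono sum_mono2) auto
  finally show ?thesis .
qed

text \<open>A real supremum dominates its members only once they are known to be bounded.
  Cauchy-Schwarz on each row gives the sum of the row norms as a crude bound; any finite one will
  do.\<close>

lemma mat_nrm_bdd_above:
  "bdd_above ((\<lambda>v. vec_nrm (A *\<^sub>v v) / vec_nrm v) ` carrier_vec (dim_col A))"
proof -
  define B where "B = (\<Sum>i<dim_row A. vec_nrm (row A i))"
  have B0: "0 \<le> B" unfolding B_def by (intro sum_nonneg vec_nrm_nonneg)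
  have "vec_nrm (A *\<^sub>v v) / vec_nrm v \<le> B" if v: "v \<in> carrier_vec (dim_col A)" for v
  proof -
    have "vec_nrm (A *\<^sub>v v) \<le> (\<Sum>i<dim_row A. \<bar>row A i \<bullet> v\<bar>)"
      using L2_set_le_sum_abs[of "\<lambda>i. (A *\<^sub>v v) $ i" "{..<dim_row A}"]
      by (simp add: vec_nrm_def)
    also have "\<dots> \<le> (\<Sum>i<dim_row A. vec_nrm (row A i) * vec_nrm v)"
      using v by (intro sum_mono abs_scalar_prod_le[where n = "dim_col A"]) auto
    finally have "vec_nrm (A *\<^sub>v v) \<le> B * vec_nrm v"
      by (simp add: B_def sum_distrib_right)
    then show ?thesis
      using B0 vec_nrm_nonneg[of v] by (cases "vec_nrm v = 0") (simp_all add: divide_simps)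
  qed
  then show ?thesis by (intro bdd_aboveI[where M = B]) auto
qed

text \<open>The witness is the zero vector, whose quotient is 0 by division by zero. It exists in
  every dimension, so matrices without columns are covered.\<close>

lemma mat_nrm_nonneg: "0 \<le> mat_nrm A"
  unfolding mat_nrm_def
  by (rule cSUP_upper2[OF mat_nrm_bdd_above, of "0\<^sub>v (dim_col A)"])
     (auto simp: vec_nrm_nonneg vec_nrm_zero)

lemma vec_nrm_eq_zeroD:
  assumes "vec_nrm v = 0" shows "v = 0\<^sub>v (dim_vec v)"
  using assms by (intro eq_vecI) (auto simp: vec_nrm_def L2_set_eq_0_iff)

lemma vec_nrm_mult_mat_vec_le:
  assumes v: "v \<in> carrier_vec (dim_col A)"
  shows "vec_nrm (A *\<^sub>v v) \<le> mat_nrm A * vec_nrm v"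
proof (cases "vec_nrm v = 0")
  case True
  then have "v = 0\<^sub>v (dim_col A)" using vec_nrm_eq_zeroD[of v] v by auto
  then have "A *\<^sub>v v = 0\<^sub>v (dim_row A)" by (intro eq_vecI) auto
  then show ?thesis using True by (simp add: vec_nrm_zero)
next
  case False
  then have "0 < vec_nrm v" using vec_nrm_nonneg[of v] by simp
  moreover have "vec_nrm (A *\<^sub>v v) / vec_nrm v \<le> mat_nrm A"
    unfolding mat_nrm_def using mat_nrm_bdd_above v by (intro cSUP_upper)
  ultimately show ?thesis by (simp add: divide_simps)
qed

text \<open>The plant multiplies by the transpose, while the variation is measured on the parameter
  itself. With \<open>?u\<close> the image of \<open>v\<close>, the square of its norm is
  \<open>v \<bullet> (A *\<^sub>v ?u)\<close>, at most
  \<open>vec_nrm v * (mat_nrm A * vec_nrm ?u)\<close>, and one factor cancels.\<close>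

lemma vec_nrm_transpose_mult_le:
  assumes A: "A \<in> carrier_mat m n" and v: "v \<in> carrier_vec m"
  shows "vec_nrm (transpose_mat A *\<^sub>v v) \<le> mat_nrm A * vec_nrm v"
proof -
  let ?u = "transpose_mat A *\<^sub>v v"
  have u: "?u \<in> carrier_vec n" using A v by (intro mult_mat_vec_carrier[of _ n m]) auto
  have Au: "A *\<^sub>v ?u \<in> carrier_vec m" using A u by (rule mult_mat_vec_carrier)
  have "vec_nrm ?u ^ 2 = v \<bullet> (A *\<^sub>v ?u)"
    using transpose_vec_mult_scalar[OF A u v] comm_scalar_prod[OF v Au] comm_scalar_prod[OF u u]
    by (simp add: vec_nrm_square)
  also have "\<dots> \<le> vec_nrm v * vec_nrm (A *\<^sub>v ?u)"
    using abs_scalar_prod_le[OF v Au] by simp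
  also have "\<dots> \<le> vec_nrm v * (mat_nrm A * vec_nrm ?u)"
    using A u by (intro mult_left_mono vec_nrm_mult_mat_vec_le vec_nrm_nonneg) auto
  finally have "vec_nrm ?u * vec_nrm ?u \<le> (mat_nrm A * vec_nrm v) * vec_nrm ?u"
    by (simp add: power2_eq_square mult_ac)
  moreover have "0 \<le> mat_nrm A * vec_nrm v" by (simp add: mat_nrm_nonneg vec_nrm_nonneg)
  ultimately show ?thesis
    using vec_nrm_nonneg[of ?u] by (cases "vec_nrm ?u = 0") auto
qed

section \<open>Accumulated variation of the parameter\<close>

lemma vec_diff_split:
  fixes a b c :: "real vec"
  assumes "a \<in> carrier_vec n" "b \<in> carrier_vec n" "c \<in> carrier_vec n"
  shows "a - c = (a - b) + (b - c)"
  using assms by (intro eq_vecI) auto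

text \<open>Telescoping from \<open>T\<close> to \<open>T + int k\<close>: each step applies one
  transposed increment to the same vector \<open>v\<close>.\<close>

lemma vec_nrm_transpose_diff_le:
  fixes \<theta> :: "int \<Rightarrow> real mat"
  assumes \<theta>: "\<And>t. \<theta> t \<in> carrier_mat m n" and v: "v \<in> carrier_vec m"
  shows "vec_nrm (transpose_mat (\<theta> (T + int k)) *\<^sub>v v - transpose_mat (\<theta> T) *\<^sub>v v)
      \<le> (\<Sum>i<k. mat_nrm (\<theta> (T + int i + 1) - \<theta> (T + int i))) * vec_nrm v"
proof (induction k)
  case 0
  have "transpose_mat (\<theta> T) *\<^sub>v v \<in> carrier_vec n" using \<theta> v by (intro mult_mat_vec_carrier[of _ n m]) auto
  then show ?case by (simp add: vec_nrm_zero)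
next
  case (Suc k)
  let ?g = "\<lambda>t. transpose_mat (\<theta> t) *\<^sub>v v"
  let ?t = "T + int k"
  let ?D = "\<theta> (?t + 1) - \<theta> ?t"
  have g: "?g t \<in> carrier_vec n" for t using \<theta> v by (intro mult_mat_vec_carrier[of _ n m]) auto
  have D: "?D \<in> carrier_mat m n" using \<theta> by (metis minus_carrier_mat)
  have "transpose_mat ?D = transpose_mat (\<theta> (?t + 1)) - transpose_mat (\<theta> ?t)"
    using transpose_minus[OF \<theta> \<theta>] by blast
  then have Dv: "transpose_mat ?D *\<^sub>v v = ?g (?t + 1) - ?g ?t"
    using minus_mult_distrib_mat_vec[of "transpose_mat (\<theta> (?t + 1))" n m "transpose_mat (\<theta> ?t)" v] \<theta> v
    by simp
  have "?g (?t + 1) - ?g T = (?g (?t + 1) - ?g ?t) + (?g ?t - ?g T)"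
    by (rule vec_diff_split[OF g g g])
  then have "vec_nrm (?g (?t + 1) - ?g T) \<le> vec_nrm (?g (?t + 1) - ?g ?t) + vec_nrm (?g ?t - ?g T)"
    using vec_nrm_add_le[of "?g (?t + 1) - ?g ?t" n "?g ?t - ?g T"] g by auto
  also have "\<dots> \<le> mat_nrm ?D * vec_nrm v + (\<Sum>i<k. mat_nrm (\<theta> (T + int i + 1) - \<theta> (T + int i))) * vec_nrm v"
    using Suc.IH vec_nrm_transpose_mult_le[OF D v] Dv by simp
  finally show ?case by (simp add: algebra_simps)
qed

section \<open>Dimensions of the regressor\<close>

lemma stack_carrier:
  assumes "\<And>v. v \<in> set vs \<Longrightarrow> v \<in> carrier_vec n"
  shows "stack vs \<in> carrier_vec (length vs * n)"
  using assms by (induction vs) (auto simp: stack_def)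

lemma dim_stack_append: "dim_vec (stack (vs @ ws)) = dim_vec (stack vs) + dim_vec (stack ws)"
  by (induction vs) (auto simp: stack_def)

lemma regressor_carrier:
  assumes "y \<in> seqs (dim_y D)" "u \<in> seqs (dim_u D)"
  shows "regressor D y u t \<in> carrier_vec (n_phi D)"
proof -
  have "stack (map (\<lambda>k. y (t - int k)) [0..<lag_y D]) \<in> carrier_vec (lag_y D * dim_y D)"
    using stack_carrier[of "map (\<lambda>k. y (t - int k)) [0..<lag_y D]" "dim_y D"] assms
    by (auto simp: seqs_def)
  moreover have "stack (map (\<lambda>k. u (t - int k)) [0..<lag_u D]) \<in> carrier_vec (lag_u D * dim_u D)"
    using stack_carrier[of "map (\<lambda>k. u (t - int k)) [0..<lag_u D]" "dim_u D"] assms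
    by (auto simp: seqs_def)
  ultimately show ?thesis
    by (intro carrier_vecI) (simp add: regressor_def dim_stack_append n_phi_def)
qed

section \<open>Scalar convolution inequalities\<close>

lemma sum_int_shift:
  fixes h :: "int \<Rightarrow> real"
  shows "(\<Sum>j\<in>{\<tau> + int s..<\<tau> + int n}. h j) = (\<Sum>j\<in>{s..<n}. h (\<tau> + int j))"
proof (rule sum.reindex_bij_witness[where i = "\<lambda>j. \<tau> + int j" and j = "\<lambda>j. nat (j - \<tau>)"])
qed auto

text \<open>Part of the disturbance is proportional to \<open>X\<close>. Feeding it back for one
  step turns the factor \<open>lam\<close> into
  \<open>lam * (1 + c * \<nu> / lam * \<eta> k)\<close>, and the exponentials that dominate these
  factors multiply up to \<open>E\<close>. The hypothesis \<open>H\<close> concerns a single start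
  \<open>s\<close> and times up to \<open>n\<close>, since a frozen parameter serves one block
  only.\<close>

lemma gronwall:
  fixes X d r \<eta> :: "nat \<Rightarrow> real"
  assumes c: "1 \<le> c" and lam: "0 < lam" and \<nu>: "0 < \<nu>"
    and X: "\<And>n. 0 \<le> X n" and r: "\<And>n. r n \<le> d n" "\<And>n. 0 \<le> r n"
    and \<eta>: "\<And>n. 0 \<le> \<eta> n" "\<And>n. \<eta> n \<le> M"
    and H: "\<And>k. k \<le> n \<Longrightarrow> s \<le> k \<Longrightarrow>
      X k \<le> c * lam ^ (k - s) * X s
        + (\<Sum>j\<in>{s..<k}. c * lam ^ (k - j - 1) * (d j + \<nu> * \<eta> j * X j)) + c * r k"
    and sn: "s \<le> n"
  defines "E \<equiv> \<lambda>j k. exp (c * \<nu> / lam * (\<Sum>i\<in>{j..<k}. \<eta> i))"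
  shows "X n \<le> c * lam ^ (n - s) * E s n * X s
      + (\<Sum>j\<in>{s..<n}. c * (1 + c * \<nu> * M) * lam ^ (n - j - 1) * E j n * d j) + c * r n"
proof -
  \<comment> \<open>\<open>?v\<close> is the bound in \<open>H\<close> without its last term
    \<open>c * r k\<close>, so that it satisfies a linear one-step recursion; \<open>?b\<close> is
    the claimed bound without that term.\<close>
  let ?v = "\<lambda>k. c * lam ^ (k - s) * X s
        + (\<Sum>j\<in>{s..<k}. c * lam ^ (k - j - 1) * (d j + \<nu> * \<eta> j * X j))"
  let ?c = "c * (1 + c * \<nu> * M)"
  let ?b = "\<lambda>k. c * lam ^ (k - s) * E s k * X s + (\<Sum>j\<in>{s..<k}. ?c * lam ^ (k - j - 1) * E j k * d j)"
  have d: "0 \<le> d j" for j using r[of j] by linarith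
  have M: "0 \<le> M" using \<eta>[of 0] by linarith
  have g: "0 \<le> c * \<nu> / lam" using c \<nu> lam by simp
  have ES: "E j (Suc k) = exp (c * \<nu> / lam * \<eta> k) * E j k" if "j \<le> k" for j k
    using that by (simp add: E_def algebra_simps add_divide_distrib exp_add[symmetric])
  have E1: "1 \<le> E j k" for j k
    unfolding E_def one_le_exp_iff using g \<eta>(1) by (intro mult_nonneg_nonneg sum_nonneg)
  have b0: "0 \<le> ?b k" for k
    using c lam \<nu> M X d E1 by (intro add_nonneg_nonneg sum_nonneg mult_nonneg_nonneg) (auto intro: order_trans[OF zero_le_one])
  have "?v k \<le> ?b k" if "s \<le> k" "k \<le> n" for k
    using that
  proof (induction k rule: dec_induct)
    case base
    then show ?case by (simp add: E_def)
  next
    case (step k)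
    let ?h = "exp (c * \<nu> / lam * \<eta> k)"
    have IH: "?v k \<le> ?b k" using step by simp
    \<comment> \<open>By \<open>r k \<le> d k\<close> the direct term joins the disturbance. Fed
      back once, it raises the weight of \<open>d k\<close> from \<open>c\<close> to
      \<open>c * (1 + c * \<nu> * \<eta> k)\<close>, whence the form of \<open>?c\<close>.\<close>
    have Xk: "X k \<le> ?b k + c * d k"
    proof -
      have "X k \<le> ?v k + c * r k" using H step by simp
      also have "c * r k \<le> c * d k" using r c by simp
      finally show ?thesis using IH by linarith
    qed
    have "?v (Suc k) = lam * ?v k + c * (d k + \<nu> * \<eta> k * X k)"
    proof -
      have "(\<Sum>j\<in>{s..<Suc k}. c * lam ^ (Suc k - j - 1) * (d j + \<nu> * \<eta> j * X j))
        = lam * (\<Sum>j\<in>{s..<k}. c * lam ^ (k - j - 1) * (d j + \<nu> * \<eta> j * X j)) + c * (d k + \<nu> * \<eta> k * X k)"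
        using step(1)
        by (auto simp: sum_distrib_left mult_ac power_Suc[symmetric] Suc_diff_Suc intro!: sum.cong)
      then show ?thesis using step(1) by (simp add: Suc_diff_le algebra_simps)
    qed
    also have "\<dots> \<le> lam * ?b k + c * (d k + \<nu> * \<eta> k * (?b k + c * d k))"
      using c lam \<nu> \<eta>(1)
      by (intro add_mono[OF mult_left_mono[OF IH] mult_left_mono[OF add_left_mono[OF mult_left_mono[OF Xk]]]])
         auto
    also have "\<dots> = lam * (1 + c * \<nu> / lam * \<eta> k) * ?b k + c * (1 + c * \<nu> * \<eta> k) * d k"
      using lam by (simp add: field_simps)
    \<comment> \<open>The exponential absorbs the factor of \<open>?b k\<close>. The weight of
      \<open>d k\<close> uses \<open>\<eta> k \<le> M\<close> instead and then gains
      \<open>?h \<ge> 1\<close>, which is the factor \<open>E k (Suc k)\<close> of the new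
      summand.\<close>
    also have "\<dots> \<le> lam * ?h * ?b k + ?c * ?h * d k"
    proof (intro add_mono mult_right_mono mult_left_mono b0 d)
      show "1 + c * \<nu> / lam * \<eta> k \<le> ?h" by (rule exp_ge_add_one_self)
      have "c * (1 + c * \<nu> * \<eta> k) \<le> ?c * 1" using c \<nu> \<eta>(2) by simp
      also have "\<dots> \<le> ?c * ?h"
      proof (rule mult_left_mono)
        show "1 \<le> ?h" unfolding one_le_exp_iff by (intro mult_nonneg_nonneg g \<eta>(1))
      qed (use c \<nu> M in auto)
      finally show "c * (1 + c * \<nu> * \<eta> k) \<le> ?c * ?h" .
    qed (use lam in auto)
    also have "\<dots> = ?b (Suc k)"
    proof -
      have "(\<Sum>j\<in>{s..<k}. ?c * lam ^ (Suc k - j - 1) * E j (Suc k) * d j)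
          = lam * ?h * (\<Sum>j\<in>{s..<k}. ?c * lam ^ (k - j - 1) * E j k * d j)"
        unfolding sum_distrib_left
      proof (rule sum.cong)
        fix j assume "j \<in> {s..<k}"
        then have "lam ^ (Suc k - j - 1) = lam * lam ^ (k - j - 1)" "E j (Suc k) = ?h * E j k"
          by (auto simp: power_Suc[symmetric] Suc_diff_Suc ES)
        then show "?c * lam ^ (Suc k - j - 1) * E j (Suc k) * d j
          = lam * ?h * (?c * lam ^ (k - j - 1) * E j k * d j)" by (simp only: mult_ac)
      qed simp
      moreover have "E k (Suc k) = ?h" by (simp add: E_def)
      moreover have "lam ^ (Suc k - s) = lam * lam ^ (k - s)" "E s (Suc k) = ?h * E s k"
        using step(1) by (simp_all add: Suc_diff_le ES)
      ultimately show ?thesis using step(1) by (simp add: algebra_simps)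
    qed
    finally show ?case .
  qed
  from this[of n] show ?thesis using H[of n] sn by simp
qed

text \<open>Strong induction that cuts off the last \<open>N\<close> steps. On this block
  \<open>gronwall\<close> yields \<open>c * lam ^ N\<close>, at most \<open>\<rho> ^ N\<close>, so
  the gain \<open>c\<close> does not compound, and the factors \<open>E\<close> of adjacent
  intervals multiply exactly.\<close>

lemma glue_blocks:
  fixes X d r \<eta> :: "nat \<Rightarrow> real"
  assumes c: "1 \<le> c" and lam: "0 < lam" "lam \<le> \<rho>" "\<rho> \<le> 1" and \<nu>: "0 < \<nu>"
    and N: "0 < N" "c * lam ^ N \<le> \<rho> ^ N"
    and X: "\<And>n. 0 \<le> X n" and r: "\<And>n. r n \<le> d n" "\<And>n. 0 \<le> r n"
    and \<eta>: "\<And>n. 0 \<le> \<eta> n" "\<And>n. \<eta> n \<le> M"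
    and H: "\<And>s n. s \<le> n \<Longrightarrow> n \<le> s + N \<Longrightarrow>
      X n \<le> c * lam ^ (n - s) * X s
        + (\<Sum>j\<in>{s..<n}. c * lam ^ (n - j - 1) * (d j + \<nu> * \<eta> j * X j)) + c * r n"
  defines "E \<equiv> \<lambda>j k. exp (c * \<nu> / lam * (\<Sum>i\<in>{j..<k}. \<eta> i))"
    and "K \<equiv> c * (1 + c * \<nu> * M) + c * c"
  shows "X n \<le> K * \<rho> ^ n * E 0 n * X 0
      + (\<Sum>j\<in>{0..<n}. K * \<rho> ^ (n - j - 1) * E j n * d j) + c * r n"
proof (induction n rule: less_induct)
  case (less n)
  let ?c = "c * (1 + c * \<nu> * M)"
  have d: "0 \<le> d j" for j using r[of j] by linarith
  have M: "0 \<le> M" using \<eta>[of 0] by linarith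
  have E0: "0 < E j k" for j k by (simp add: E_def)
  have cK: "c \<le> K" "?c \<le> K" "0 \<le> ?c" "0 \<le> K"
    using c M \<nu> unfolding K_def by (auto simp: algebra_simps intro: add_increasing add_increasing2)
  have pw: "lam ^ k \<le> \<rho> ^ k" for k using lam by (intro power_mono) auto
  have coef: "?c * lam ^ k * E j n * d j \<le> K * \<rho> ^ k * E j n * d j" for k j
    using cK lam E0[of j n] d pw
    by (intro mult_right_mono mult_mono) (auto intro: less_imp_le)
  have gr: "X n \<le> c * lam ^ (n - s) * E s n * X s
      + (\<Sum>j\<in>{s..<n}. ?c * lam ^ (n - j - 1) * E j n * d j) + c * r n" if "s \<le> n" "n \<le> s + N" for s
    unfolding E_def using that
    by (intro gronwall[OF c lam(1) \<nu>] X r \<eta> H) auto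
  show ?case
  proof (cases "n \<le> N")
    case True
    have "c * lam ^ n * E 0 n * X 0 \<le> K * \<rho> ^ n * E 0 n * X 0"
      using cK lam E0[of 0 n] X pw c by (intro mult_right_mono mult_mono) (auto intro: less_imp_le)
    moreover have "(\<Sum>j\<in>{0..<n}. ?c * lam ^ (n - j - 1) * E j n * d j)
       \<le> (\<Sum>j\<in>{0..<n}. K * \<rho> ^ (n - j - 1) * E j n * d j)"
      by (intro sum_mono coef)
    ultimately show ?thesis using gr[of 0] True by simp
  next
    case False
    define s where "s = n - N"
    have s: "s < n" "n = s + N" "n - s = N" using False N by (auto simp: s_def)
    let ?A = "\<rho> ^ N * E s n"
    have A0: "0 \<le> ?A" using lam E0[of s n] by simp
    have EE: "E j s * E s n = E j n" if "j \<le> s" for j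
      using that s(1) unfolding E_def exp_add[symmetric] distrib_left[symmetric]
      by (simp add: sum.atLeastLessThan_concat)
    \<comment> \<open>The summand \<open>c * r s\<close> of the induction hypothesis is charged to the coefficient of \<open>d s\<close>,
      whence the \<open>c * c\<close> in \<open>K\<close>; each index is charged once, so \<open>K\<close> does not grow with the blocks.\<close>
    have S: "c * lam ^ N * E s n * X s \<le> ?A * (K * \<rho> ^ s * E 0 s * X 0
        + (\<Sum>j\<in>{0..<s}. K * \<rho> ^ (s - j - 1) * E j s * d j)) + c * c * \<rho> ^ (N - 1) * E s n * d s"
    proof -
      have "c * lam ^ N * E s n * X s \<le> c * lam ^ N * E s n * (K * \<rho> ^ s * E 0 s * X 0
        + (\<Sum>j\<in>{0..<s}. K * \<rho> ^ (s - j - 1) * E j s * d j) + c * r s)"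
        using less[OF s(1)] c lam E0[of s n] by (intro mult_left_mono) auto
      also have "\<dots> = c * lam ^ N * E s n * (K * \<rho> ^ s * E 0 s * X 0
        + (\<Sum>j\<in>{0..<s}. K * \<rho> ^ (s - j - 1) * E j s * d j)) + c * lam ^ N * E s n * (c * r s)"
        by (rule distrib_left)
      also have "\<dots> \<le> ?A * (K * \<rho> ^ s * E 0 s * X 0
        + (\<Sum>j\<in>{0..<s}. K * \<rho> ^ (s - j - 1) * E j s * d j)) + \<rho> ^ (N - 1) * E s n * (c * (c * d s))"
      proof (intro add_mono mult_mono)
        show "0 \<le> K * \<rho> ^ s * E 0 s * X 0 + (\<Sum>j\<in>{0..<s}. K * \<rho> ^ (s - j - 1) * E j s * d j)"
          using cK(4) lam E0 X d
          by (intro add_nonneg_nonneg sum_nonneg mult_nonneg_nonneg) (auto intro: less_imp_le)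
        \<comment> \<open>In the target sum \<open>d s\<close> carries the exponent
          \<open>n - s - 1 = N - 1\<close>, one less than the block length, so one factor
          \<open>\<rho> \<le> 1\<close> is given away.\<close>
        have "\<rho> ^ N \<le> \<rho> ^ (N - 1)" using lam by (intro power_decreasing) auto
        then show "c * lam ^ N \<le> \<rho> ^ (N - 1)" using N(2) by linarith
        have "r s \<le> d s" by (rule r)
        also have "\<dots> \<le> c * d s" using c d[of s] by (simp add: mult_le_cancel_right1)
        finally show "r s \<le> c * d s" .
      qed (use c lam N(2) E0[of s n] E0[of 0 s] X[of 0] cK(4) r[of s] in \<open>auto intro: less_imp_le add_nonneg_nonneg\<close>)
      finally show ?thesis by (simp add: mult_ac)
    qed
    have "?A * (\<Sum>j\<in>{0..<s}. K * \<rho> ^ (s - j - 1) * E j s * d j)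
      = (\<Sum>j\<in>{0..<s}. K * \<rho> ^ (n - j - 1) * E j n * d j)"
      unfolding sum_distrib_left
    proof (rule sum.cong)
      fix j assume j: "j \<in> {0..<s}"
      have "n - j - 1 = N + (s - j - 1)" using j s by auto
      then have "\<rho> ^ (n - j - 1) = \<rho> ^ N * \<rho> ^ (s - j - 1)" by (simp add: power_add)
      moreover have "E j n = E j s * E s n" using EE j by simp
      ultimately show "?A * (K * \<rho> ^ (s - j - 1) * E j s * d j) = K * \<rho> ^ (n - j - 1) * E j n * d j"
        by (simp only: mult_ac)
    qed simp
    moreover have "?A * (K * \<rho> ^ s * E 0 s * X 0) = K * \<rho> ^ n * E 0 n * X 0"
      using EE[of 0] s(2) by (simp add: power_add mult_ac flip: EE[of 0])
    \<comment> \<open>Only the summand \<open>j = s\<close> takes up the extra charge, and there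
      \<open>K\<close> is exactly the sum of the two coefficients; it is therefore split
      off.\<close>
    moreover have "(\<Sum>j\<in>{s..<n}. ?c * lam ^ (n - j - 1) * E j n * d j) + c * c * \<rho> ^ (N - 1) * E s n * d s
       \<le> (\<Sum>j\<in>{s..<n}. K * \<rho> ^ (n - j - 1) * E j n * d j)"
    proof -
      have "?c * lam ^ (N - 1) * E s n * d s + c * c * \<rho> ^ (N - 1) * E s n * d s
         \<le> ?c * \<rho> ^ (N - 1) * E s n * d s + c * c * \<rho> ^ (N - 1) * E s n * d s"
        using cK(3) E0[of s n] d pw
        by (intro add_right_mono mult_right_mono mult_left_mono) (auto intro: less_imp_le)
      also have "\<dots> = K * \<rho> ^ (N - 1) * E s n * d s" by (simp add: K_def algebra_simps)
      finally have 1: "?c * lam ^ (N - 1) * E s n * d s + c * c * \<rho> ^ (N - 1) * E s n * d s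
         \<le> K * \<rho> ^ (N - 1) * E s n * d s" .
      have 2: "(\<Sum>j\<in>{Suc s..<n}. ?c * lam ^ (n - j - 1) * E j n * d j)
         \<le> (\<Sum>j\<in>{Suc s..<n}. K * \<rho> ^ (n - j - 1) * E j n * d j)"
        by (intro sum_mono coef)
      show ?thesis
        using 1 2 s(3) by (simp only: sum.atLeast_Suc_lessThan[OF s(1)])
    qed
    moreover have "(\<Sum>j\<in>{0..<n}. K * \<rho> ^ (n - j - 1) * E j n * d j)
      = (\<Sum>j\<in>{0..<s}. K * \<rho> ^ (n - j - 1) * E j n * d j) + (\<Sum>j\<in>{s..<n}. K * \<rho> ^ (n - j - 1) * E j n * d j)"
      using s(1) by (simp add: sum.atLeastLessThan_concat)
    ultimately show ?thesis
      using gr[of s, unfolded s(3)] S[unfolded distrib_left[of "\<rho> ^ N * E s n"]] s(1,2) by linarith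
  qed
qed

section \<open>Freezing the parameter over one block\<close>

lemma frozen_parameter_bound:
  assumes f: "f \<in> carrier_vec (n_phi D) \<rightarrow> carrier_vec (dim_p D)"
    and \<nu>: "0 \<le> \<nu>" "\<And>x. x \<in> carrier_vec (n_phi D) \<Longrightarrow> vec_nrm (f x) \<le> \<nu> * vec_nrm x"
    and cb: "convolution_bound D f (const_params S) C c lam"
    and \<theta>: "\<And>t. \<theta> t \<in> S" "\<And>t. \<theta> t \<in> carrier_mat (dim_p D) (dim_y D)"
    and sig: "\<phi>0 \<in> carrier_vec (n_phi D)" "z10 \<in> carrier_vec (dim_z1 D)" "z20 \<in> z2_set C"
      "w \<in> seqs (dim_y D)" "r \<in> seqs (dim_r D)" "y \<in> seqs (dim_y D)" "u \<in> seqs (dim_u D)"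
    and cl: "closed_loop D f C \<theta> t0 \<phi>0 z10 z20 w r y u z1 z2"
    and T: "t0 \<le> T" "T \<le> t" "t \<le> T + int N"
  defines "x \<equiv> \<lambda>t. vec_nrm (regressor D y u t @\<^sub>v z1 t)"
    and "\<delta> \<equiv> \<lambda>t. mat_nrm (\<theta> (t + 1) - \<theta> t)"
  shows "x t \<le> c * lam ^ nat (t - T) * x T
     + (\<Sum>j\<in>{T..<t}. c * lam ^ nat (t - j - 1) *
          (vec_nrm (r j) + vec_nrm (w j) + \<nu> * (\<Sum>m\<in>{1..N}. \<delta> (j - int m)) * x j))
     + c * vec_nrm (r t)"
proof -
  let ?\<phi> = "regressor D y u"
  let ?g = "\<lambda>s t. transpose_mat (\<theta> s) *\<^sub>v f (?\<phi> t)"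
  define w' where "w' t = y (t + 1) - ?g T t" for t
  have c: "1 \<le> c" "0 < lam" using cb unfolding convolution_bound_def by blast+
  have yc: "y t \<in> carrier_vec (dim_y D)" for t using sig by (simp add: seqs_def)
  have wc: "w t \<in> carrier_vec (dim_y D)" for t using sig by (simp add: seqs_def)
  have \<phi>: "?\<phi> t \<in> carrier_vec (n_phi D)" for t using sig by (intro regressor_carrier)
  have fv: "f (?\<phi> t) \<in> carrier_vec (dim_p D)" for t using f \<phi> by auto
  have g: "?g s t \<in> carrier_vec (dim_y D)" for s t
    using \<theta>(2) fv by (intro mult_mat_vec_carrier[of _ "dim_y D" "dim_p D"]) auto
  have a1: "a = b + (a - b)" if "a \<in> carrier_vec k" "b \<in> carrier_vec k" for a b :: "real vec" and k
    using that by (intro eq_vecI) auto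
  have a2: "a + b - d = b + (a - d)"
    if "a \<in> carrier_vec k" "b \<in> carrier_vec k" "d \<in> carrier_vec k" for a b d :: "real vec" and k
    using that by (intro eq_vecI) auto
  have w': "w' \<in> seqs (dim_y D)" using g yc by (auto simp: seqs_def w'_def)
  have "y (t + 1) = ?g T t + w' t" for t
    unfolding w'_def by (rule a1[OF yc g])
  then have cl': "closed_loop D f C (\<lambda>_. \<theta> T) t0 \<phi>0 z10 z20 w' r y u z1 z2"
    using cl by (simp add: closed_loop_def)
  have mem: "(\<lambda>_. \<theta> T) \<in> const_params S" using \<theta>(1) by (auto simp: const_params_def)
  \<comment> \<open>The loop keeps its start \<open>t0\<close>, on which the update maps may depend;
    only the bound is started at \<open>T\<close>. Hence \<open>w'\<close> never has to be estimated
    before \<open>T\<close>.\<close>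
  have main: "x t \<le> c * lam ^ nat (t - T) * x T
     + (\<Sum>j\<in>{T..<t}. c * lam ^ nat (t - j - 1) * (vec_nrm (r j) + vec_nrm (w' j)))
     + c * vec_nrm (r t)"
    using cb mem sig w' cl' T unfolding convolution_bound_def x_def by blast
  have wb: "vec_nrm (w' j) \<le> vec_nrm (w j) + \<nu> * (\<Sum>m\<in>{1..N}. \<delta> (j - int m)) * x j"
    if j: "j \<in> {T..<t}" for j
  proof -
    define k where "k = nat (j - T)"
    have k: "j = T + int k" "k \<le> N" using j T by (auto simp: k_def)
    have \<delta>0: "0 \<le> \<delta> i" for i by (simp add: \<delta>_def mat_nrm_nonneg)
    have "y (j + 1) = ?g j j + w j" using cl j T by (simp add: closed_loop_def)
    then have "w' j = w j + (?g j j - ?g T j)"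
      unfolding w'_def using a2[OF g wc g] by simp
    then have "vec_nrm (w' j) \<le> vec_nrm (w j) + vec_nrm (?g j j - ?g T j)"
      using vec_nrm_add_le[OF wc, of "?g j j - ?g T j"] g by auto
    also have "vec_nrm (?g j j - ?g T j) \<le> (\<Sum>i<k. \<delta> (T + int i)) * vec_nrm (f (?\<phi> j))"
      using vec_nrm_transpose_diff_le[of \<theta>, OF \<theta>(2) fv, where T = T and k = k] k unfolding \<delta>_def by simp
    also have "\<dots> \<le> (\<Sum>m\<in>{1..N}. \<delta> (j - int m)) * (\<nu> * x j)"
    proof (intro mult_mono)
      have "(\<Sum>i<k. \<delta> (T + int i)) = (\<Sum>m\<in>{1..k}. \<delta> (j - int m))"
        by (rule sum.reindex_bij_witness[where i = "\<lambda>m. k - m" and j = "\<lambda>i. k - i"])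
           (auto simp: k of_nat_diff)
      \<comment> \<open>Enlarging the window from the \<open>k\<close> steps since \<open>T\<close>
        to \<open>N\<close> steps removes the dependence on \<open>T\<close>, so one weight serves
        all blocks.\<close>
      also have "\<dots> \<le> (\<Sum>m\<in>{1..N}. \<delta> (j - int m))"
        using k \<delta>0 by (intro sum_mono2) auto
      finally show "(\<Sum>i<k. \<delta> (T + int i)) \<le> (\<Sum>m\<in>{1..N}. \<delta> (j - int m))" .
      have "vec_nrm (f (?\<phi> j)) \<le> \<nu> * vec_nrm (?\<phi> j)" by (rule \<nu>(2)[OF \<phi>])
      also have "\<dots> \<le> \<nu> * x j"
        unfolding x_def by (intro mult_left_mono vec_nrm_append_ge \<nu>(1))
      finally show "vec_nrm (f (?\<phi> j)) \<le> \<nu> * x j" .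
    qed (use \<delta>0 in \<open>auto intro: sum_nonneg vec_nrm_nonneg\<close>)
    finally show ?thesis by (simp add: mult_ac)
  qed
  have "(\<Sum>j\<in>{T..<t}. c * lam ^ nat (t - j - 1) * (vec_nrm (r j) + vec_nrm (w' j)))
    \<le> (\<Sum>j\<in>{T..<t}. c * lam ^ nat (t - j - 1) *
          (vec_nrm (r j) + vec_nrm (w j) + \<nu> * (\<Sum>m\<in>{1..N}. \<delta> (j - int m)) * x j))"
    using wb c by (intro sum_mono mult_left_mono) (auto simp: add.assoc)
  then show ?thesis using main by linarith
qed

section \<open>Choice of the constants and passage to the time-varying loop\<close>

theorem theorem1:
  fixes D :: dims
    and f :: "real vec \<Rightarrow> real vec"
    and S :: "real mat set"
    and C :: controller
    and c lam :: real
  assumes "f \<in> carrier_vec (n_phi D) \<rightarrow> carrier_vec (dim_p D)"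
    and "bounded_gain (n_phi D) f"
    and "S \<subseteq> carrier_mat (dim_p D) (dim_y D)"
    and "bounded_mats S"
    and "wf_controller D C"
    and "convolution_bound D f (const_params S) C c lam"
  shows "\<forall>lam1. lam < lam1 \<and> lam1 < 1 \<longrightarrow>
           (\<forall>c0>0. \<exists>c1 \<epsilon>. c \<le> c1 \<and> 0 < \<epsilon> \<and>
              convolution_bound D f (slow_params D S c0 \<epsilon>) C c1 lam1)"
proof (intro allI impI)
  fix lam1 c0 :: real
  assume lam1: "lam < lam1 \<and> lam1 < 1" and c0: "0 < c0"
  have c: "1 \<le> c" and lam: "0 < lam"
    using assms(6) unfolding convolution_bound_def by blast+
  obtain \<nu> where \<nu>: "0 < \<nu>" "\<And>x. x \<in> carrier_vec (n_phi D) \<Longrightarrow> vec_nrm (f x) \<le> \<nu> * vec_nrm x"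
    using assms(2) by (auto simp: bounded_gain_def)
  \<comment> \<open>The gap from \<open>lam\<close> to \<open>\<rho>\<close> pays for the gain
    \<open>c\<close> of each block, the gap from \<open>\<rho>\<close> to \<open>lam1\<close> for
    the parameter variation.\<close>
  define \<rho> where "\<rho> = (lam + lam1) / 2"
  have \<rho>: "lam < \<rho>" "\<rho> < lam1" "\<rho> < 1" "0 < \<rho>" using lam1 lam by (auto simp: \<rho>_def)
  obtain N where N: "0 < N" "c * lam ^ N \<le> \<rho> ^ N"
  proof -
    obtain n where n: "(lam / \<rho>) ^ n < 1 / c"
      using real_arch_pow_inv[of "1 / c" "lam / \<rho>"] c \<rho> by auto
    have "(lam / \<rho>) ^ Suc n \<le> (lam / \<rho>) ^ n"
      using lam \<rho> by (intro power_decreasing) auto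
    with n have "(lam / \<rho>) ^ Suc n \<le> 1 / c" by linarith
    then have "c * lam ^ Suc n \<le> \<rho> ^ Suc n"
      using c \<rho> by (simp add: power_divide field_simps)
    then show ?thesis using that[of "Suc n"] by simp
  qed
  define g where "g = c * \<nu> / lam"
  \<comment> \<open>Solves \<open>\<rho> * exp (g * N * \<epsilon>) = lam1\<close>. The factor
    \<open>N\<close> enters because each increment of the parameter is counted in up to
    \<open>N\<close> windows.\<close>
  define \<epsilon> where "\<epsilon> = ln (lam1 / \<rho>) / (g * N)"
  have g: "0 < g" using c \<nu> lam by (simp add: g_def)
  have \<epsilon>: "0 < \<epsilon>" using g N(1) \<rho> by (simp add: \<epsilon>_def)
  have "g * N * \<epsilon> = ln (lam1 / \<rho>)" using g N(1) by (simp add: \<epsilon>_def)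
  then have grow: "\<rho> * exp (g * N * \<epsilon>) = lam1" using \<rho> by simp
  \<comment> \<open>Bounds one window: each of its \<open>N\<close> increments is a variation over
    an interval of length one, at most \<open>c0 + \<epsilon>\<close>.\<close>
  define M where "M = N * (c0 + \<epsilon>)"
  define K where "K = c * (1 + c * \<nu> * M) + c * c"
  \<comment> \<open>The allowance \<open>c0\<close> is paid once. The additional
    \<open>\<epsilon>\<close> covers an off-by-one: \<open>d j\<close> comes with
    \<open>n - j - 1\<close> powers of the decay rate but with variation over \<open>n - j\<close>
    steps.\<close>
  define Q where "Q = exp (g * N * (c0 + \<epsilon>))"
  define c1 where "c1 = K * Q"
  have M: "0 \<le> M" using c0 \<epsilon> by (simp add: M_def)
  have "c * 1 + 0 \<le> K" unfolding K_def using c \<nu>(1) M by (intro add_mono mult_left_mono) auto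
  then have K: "c \<le> K" by simp
  have "1 \<le> Q" unfolding Q_def one_le_exp_iff using g c0 \<epsilon> by (intro mult_nonneg_nonneg) auto
  then have "K * 1 \<le> c1" unfolding c1_def using K c by (intro mult_left_mono) auto
  then have c1: "c \<le> c1" using K by simp
  \<comment> \<open>Used with \<open>k' = k\<close> for the initial state and with
    \<open>k' = k + 1\<close> for the disturbance terms.\<close>
  have exp_le: "K * \<rho> ^ k * exp (g * (N * (c0 + \<epsilon> * k'))) \<le> c1 * lam1 ^ k"
    if "k' \<le> k + 1" for k k' :: nat
  proof -
    have "exp (g * (N * (c0 + \<epsilon> * k'))) \<le> exp (g * (N * (c0 + \<epsilon> * real (k + 1))))"
      unfolding exp_le_cancel_iff using that g \<epsilon>
      by (intro mult_left_mono add_left_mono of_nat_mono) auto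
    also have "g * (N * (c0 + \<epsilon> * real (k + 1))) = g * N * (c0 + \<epsilon>) + real k * (g * N * \<epsilon>)"
      by (simp add: algebra_simps)
    also have "exp \<dots> = Q * exp (g * N * \<epsilon>) ^ k"
      by (simp only: exp_add exp_of_nat_mult Q_def)
    finally have "K * \<rho> ^ k * exp (g * (N * (c0 + \<epsilon> * k'))) \<le> K * \<rho> ^ k * (Q * exp (g * N * \<epsilon>) ^ k)"
      using K c \<rho> by (intro mult_left_mono) auto
    also have "\<dots> = c1 * (\<rho> * exp (g * N * \<epsilon>)) ^ k" by (simp add: c1_def power_mult_distrib mult_ac)
    finally show ?thesis unfolding grow .
  qed
  have "convolution_bound D f (slow_params D S c0 \<epsilon>) C c1 lam1"
    unfolding convolution_bound_def
  proof (intro conjI ballI allI impI)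
    show "1 \<le> c1" "0 < lam1" "lam1 < 1" using c c1 lam lam1 by auto
  next
    fix \<theta> t0 \<phi>0 z10 z20 w r y u z1 z2 \<tau> t
    assume \<theta>: "\<theta> \<in> slow_params D S c0 \<epsilon>"
      and sig: "\<phi>0 \<in> carrier_vec (n_phi D)" "z10 \<in> carrier_vec (dim_z1 D)" "z20 \<in> z2_set C"
        "w \<in> seqs (dim_y D)" "r \<in> seqs (dim_r D)" "y \<in> seqs (dim_y D)" "u \<in> seqs (dim_u D)"
      and cl: "closed_loop D f C \<theta> t0 \<phi>0 z10 z20 w r y u z1 z2"
      and \<tau>: "t0 \<le> \<tau>" "\<tau> \<le> t"
    define x where "x t = vec_nrm (regressor D y u t @\<^sub>v z1 t)" for t
    define \<delta> where "\<delta> t = mat_nrm (\<theta> (t + 1) - \<theta> t)" for t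
    define \<eta> where "\<eta> t = (\<Sum>m\<in>{1..N}. \<delta> (t - int m))" for t
    define d where "d t = vec_nrm (r t) + vec_nrm (w t)" for t
    have \<theta>S: "\<theta> t \<in> S" "\<theta> t \<in> carrier_mat (dim_p D) (dim_y D)" for t
      using \<theta> by (auto simp: slow_params_def linf_seqs_def)
    have \<delta>0: "0 \<le> \<delta> t" for t by (simp add: \<delta>_def mat_nrm_nonneg)
    have slow: "(\<Sum>t\<in>{t1..<t2}. \<delta> t) \<le> c0 + \<epsilon> * of_int (t2 - t1)" if "t1 < t2" for t1 t2
      using \<theta> that by (simp add: slow_params_def \<delta>_def)
    \<comment> \<open>The lagged interval may reach back before \<tau> and even before
      \<open>t0\<close>, which is harmless because the class bounds the variation on all of
      \<open>int\<close>. For \<open>j \<ge> k\<close> the sum is empty and \<open>0 < c0\<close>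
      suffices.\<close>
    have var: "(\<Sum>i\<in>{j..<k}. \<delta> (\<tau> + int i - int m)) \<le> c0 + \<epsilon> * real (k - j)" for j k m :: nat
    proof (cases "j < k")
      case True
      let ?s = "\<tau> - int m"
      have "(\<Sum>i\<in>{j..<k}. \<delta> (\<tau> + int i - int m)) = (\<Sum>i\<in>{?s + int j..<?s + int k}. \<delta> i)"
        unfolding sum_int_shift by (simp add: algebra_simps)
      also have "\<dots> \<le> c0 + \<epsilon> * of_int ((?s + int k) - (?s + int j))"
        by (rule slow) (use True in simp)
      finally show ?thesis using True by (simp add: of_nat_diff)
    qed (use c0 in auto)
    \<comment> \<open>Summing over time first, each of the \<open>N\<close> lags sees a shifted
      interval of the same length.\<close>
    have \<eta>_sum: "(\<Sum>i\<in>{j..<k}. \<eta> (\<tau> + int i)) \<le> N * (c0 + \<epsilon> * real (k - j))" for j k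
    proof -
      have "(\<Sum>i\<in>{j..<k}. \<eta> (\<tau> + int i)) = (\<Sum>m\<in>{1..N}. \<Sum>i\<in>{j..<k}. \<delta> (\<tau> + int i - int m))"
        unfolding \<eta>_def by (rule sum.swap)
      also have "\<dots> \<le> (\<Sum>m\<in>{1..N}. c0 + \<epsilon> * real (k - j))" by (intro sum_mono var)
      finally show ?thesis by simp
    qed
    define n where "n = nat (t - \<tau>)"
    have t: "t = \<tau> + int n" using \<tau> by (simp add: n_def)
    let ?E = "\<lambda>j. exp (c * \<nu> / lam * (\<Sum>i\<in>{j..<n}. \<eta> (\<tau> + int i)))"
    have E: "?E j \<le> exp (g * (N * (c0 + \<epsilon> * real (n - j))))" for j
      unfolding g_def[symmetric] using g \<eta>_sum[of j n] by simp
    have r0: "0 \<le> vec_nrm (r t)" "vec_nrm (r t) \<le> d t" for t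
      by (simp_all add: d_def vec_nrm_nonneg)
    have d0: "0 \<le> d t" for t using r0[of t] by linarith
    have x0: "0 \<le> x t" for t by (simp add: x_def vec_nrm_nonneg)
    have \<eta>0: "0 \<le> \<eta> (\<tau> + int k)" for k unfolding \<eta>_def by (intro sum_nonneg \<delta>0)
    have \<eta>M: "\<eta> (\<tau> + int k) \<le> M" for k using \<eta>_sum[of k "Suc k"] by (simp add: M_def)
    \<comment> \<open>The parameter is frozen anew at each block start
      \<open>\<tau> + int s\<close>, while \<open>d\<close> and \<eta> stay the same for all
      \<open>s\<close>.\<close>
    have H: "x (\<tau> + int k) \<le> c * lam ^ (k - s) * x (\<tau> + int s)
        + (\<Sum>j\<in>{s..<k}. c * lam ^ (k - j - 1) * (d (\<tau> + int j) + \<nu> * \<eta> (\<tau> + int j) * x (\<tau> + int j)))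
        + c * vec_nrm (r (\<tau> + int k))" if sk: "s \<le> k" "k \<le> s + N" for s k
    proof -
      have "x (\<tau> + int k) \<le> c * lam ^ nat ((\<tau> + int k) - (\<tau> + int s)) * x (\<tau> + int s)
        + (\<Sum>j\<in>{\<tau> + int s..<\<tau> + int k}. c * lam ^ nat ((\<tau> + int k) - j - 1) * (d j + \<nu> * \<eta> j * x j))
        + c * vec_nrm (r (\<tau> + int k))"
        using frozen_parameter_bound[OF assms(1) less_imp_le[OF \<nu>(1)] \<nu>(2) assms(6) \<theta>S sig cl,
            of "\<tau> + int s" "\<tau> + int k" N] \<tau>(1) sk
        unfolding x_def \<delta>_def \<eta>_def d_def by simp
      also have "(\<Sum>j\<in>{\<tau> + int s..<\<tau> + int k}. c * lam ^ nat ((\<tau> + int k) - j - 1) * (d j + \<nu> * \<eta> j * x j))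
        = (\<Sum>j\<in>{s..<k}. c * lam ^ (k - j - 1) * (d (\<tau> + int j) + \<nu> * \<eta> (\<tau> + int j) * x (\<tau> + int j)))"
        unfolding sum_int_shift by (intro sum.cong) (auto simp: nat_diff_distrib')
      finally show ?thesis
        using sk by (simp add: nat_diff_distrib')
    qed
    have "x (\<tau> + int n) \<le> K * \<rho> ^ n * ?E 0 * x (\<tau> + int 0)
        + (\<Sum>j\<in>{0..<n}. K * \<rho> ^ (n - j - 1) * ?E j * d (\<tau> + int j)) + c * vec_nrm (r (\<tau> + int n))"
      unfolding K_def
      by (rule glue_blocks[where X = "\<lambda>n. x (\<tau> + int n)" and d = "\<lambda>n. d (\<tau> + int n)"
            and \<eta> = "\<lambda>n. \<eta> (\<tau> + int n)" and r = "\<lambda>n. vec_nrm (r (\<tau> + int n))"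
            and n = n and M = M and \<nu> = \<nu>,
          OF c lam less_imp_le[OF \<rho>(1)] less_imp_le[OF \<rho>(3)] \<nu>(1) N x0 r0(2) r0(1) \<eta>0 \<eta>M H])
    also have "\<dots> \<le> c1 * lam1 ^ n * x (\<tau> + int 0)
        + (\<Sum>j\<in>{0..<n}. c1 * lam1 ^ (n - j - 1) * d (\<tau> + int j)) + c1 * vec_nrm (r (\<tau> + int n))"
    proof -
      have bound: "K * \<rho> ^ k * ?E j \<le> c1 * lam1 ^ k" if "n - j \<le> k + 1" for k j
      proof (rule order_trans[OF mult_left_mono[OF E] exp_le[OF that]])
        show "0 \<le> K * \<rho> ^ k" using K c \<rho> by simp
      qed
      show ?thesis
        using bound c1 by (intro add_mono sum_mono mult_right_mono x0 d0 r0) auto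
    qed
    also have "(\<Sum>j\<in>{0..<n}. c1 * lam1 ^ (n - j - 1) * d (\<tau> + int j))
      = (\<Sum>j\<in>{\<tau> + int 0..<\<tau> + int n}. c1 * lam1 ^ nat (t - j - 1) * d j)"
      unfolding sum_int_shift t by (intro sum.cong) (auto simp: nat_diff_distrib')
    finally show "vec_nrm (regressor D y u t @\<^sub>v z1 t)
       \<le> c1 * lam1 ^ nat (t - \<tau>) * vec_nrm (regressor D y u \<tau> @\<^sub>v z1 \<tau>)
         + (\<Sum>j\<in>{\<tau>..<t}. c1 * lam1 ^ nat (t - j - 1) * (vec_nrm (r j) + vec_nrm (w j)))
         + c1 * vec_nrm (r t)"
      by (simp add: x_def d_def t)
  qed
  with c1 \<epsilon> show "\<exists>c1 \<epsilon>. c \<le> c1 \<and> 0 < \<epsilon> \<and>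
      convolution_bound D f (slow_params D S c0 \<epsilon>) C c1 lam1"
    by blast
qed

end
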